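(* Let $A_{-1},A_0,A_1$ be the semi-infinite matrices described in the context, let $G$ and $R$ be the minimal nonnegative solutions of $A_1X^2+A_0X+A_{-1}=X$ and $A_1+XA_0+X^2A_{-1}=X$, respectively, and let $W=I-A_0-A_1G$. Let $\Delta_{A_i}$, $i=-1,0,1$, be perturbations of the coefficients and $\Delta_G$ the corresponding perturbation of $G$, as described in the context. If $A_{-1}\mathbf 1>A_1\mathbf 1$, then for the perturbation $\Delta_G$ we have \[ \|\Delta_G\|_\infty\le\frac{\|W^{-1}\|_\infty}{1-\|W^{-1}RW\|_\infty}\|\Delta_A\|_\infty \le\frac1{\theta(1-\gamma)}\|\Delta_A\|_\infty\le\frac1{\theta(1-\gamma)}\bigl(\|\Delta_{A_{-1}}\|_\infty+\|\Delta_{A_0}\|_\infty+\|\Delta_{A_1}\|_\infty\bigr), \] where \[ \theta=\min\{a_{-1}(1),b_{-1}(1)\},\qquad \gamma=\max\left\{\frac{a_1(1)}{a_{-1}(1)},\frac{b_1(1)}{b_{-1}(1)}\right\},\qquad \Delta_A=\Delta_{A_1}G^2+\Delta_{A_0}G+\Delta_{A_{-1}}. \]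
   Context: For $i=-1,0,1$, $A_i$ is the semi-infinite tridiagonal matrix (rows and columns indexed by $1,2,\ldots$) whose first row is $[b_{i,0},b_{i,1},0,\ldots]$ and whose $r$-th row, $r\ge2$, has entries $a_{i,-1},a_{i,0},a_{i,1}$ in columns $r-1,r,r+1$ and zeros elsewhere. Here $a_{i,j}\ge0$, $b_{i,j}\ge0$, $\sum_{i,j=-1}^1a_{i,j}=1$ and $\sum_{i=-1}^1\sum_{j=0}^1b_{i,j}=1$. Hence $(A_{-1}+A_0+A_1)\mathbf 1=\mathbf 1$, where $\mathbf 1$ is the infinite vector of all ones. Set $a_i(z)=a_{i,-1}z^{-1}+a_{i,0}+a_{i,1}z$ and $b_i(z)=b_{i,0}+b_{i,1}z$. It is also assumed throughout that there exists $i$ such that $a_{i,j}\ne0$ for at least two values of $j$. Inequalities between vectors and matrices are entrywise; thus $A_{-1}\mathbf 1>A_1\mathbf 1$ means $a_{-1}(1)>a_1(1)$ and $b_{-1}(1)>b_1(1)$. $\mathcal L_\infty$ is the Banach algebra of semi-infinite matrices $A=(a_{i,j})$ that define bounded operators $\ell^\infty\to\ell^\infty$, with norm $\|A\|_\infty=\sup_i\sum_j|a_{i,j}|$; $I$ is the identity matrix. The Wiener class is $\mathcal W=\{f(z)=\sum_{i\in\mathbb Z}f_iz^i:\ \sum_{i\in\mathbb Z}|f_i|<\infty\}$. For $f\in\mathcal W$, $T(f)$ is the semi-infinite Toeplitz matrix with $(T(f))_{i,j}=f_{j-i}$. $\mathcal{QT}$ is the set of matrices $T(f)+E$ with $f\in\mathcal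 W$ and $E=(e_{i,j})\in\mathcal L_\infty$ such that $\lim_{i\to\infty}\sum_j|e_{i,j}|=0$. A solution $X\ge0$ of a matrix equation is minimal nonnegative if $Y-X\ge0$ for every other nonnegative solution $Y$. It is known that the minimal nonnegative solutions $G$ and $R$ exist, that $G\mathbf 1\le\mathbf 1$, and that $A_1=RW$, $A_{-1}=WG$. Perturbations: $\Delta_{A_i}\in\mathcal{QT}$ are such that $A_i+\Delta_{A_i}\ge0$ for $i=-1,0,1$ and $\sum_{i=-1}^1(A_i+\Delta_{A_i})\mathbf 1=\mathbf 1$. The minimal nonnegative solution of the perturbed equation $(A_1+\Delta_{A_1})X^2+(A_0+\Delta_{A_0})X+A_{-1}+\Delta_{A_{-1}}=X$ is written as $G+\Delta_G$, with $\Delta_G\in\mathcal{QT}$. The perturbation analysis in which the result is stated is a first-order one: second and higher order terms in the perturbations are omitted, so that $\Delta_G$ is governed by the relation $(I-A_1G-A_0)\Delta_G-A_1\Delta_G G=\Delta_A$ up to such terms. *)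

theory Defs
  imports "HOL-Analysis.Analysis" "HOL-Library.Function_Algebras"
begin

text \<open>
  Semi-infinite matrices and vectors are functions on \<^typ>\<open>nat\<close>, with indices starting at 0
  instead of 1. Addition, subtraction, \<^term>\<open>0\<close> and the order are the pointwise ones. Pitfall:
  the \<^term>\<open>1\<close> and the multiplication of \<^theory>\<open>HOL-Library.Function_Algebras\<close> are pointwise
  too, so the identity matrix and the matrix product have their own names below.
\<close>

type_synonym imat = "nat \<Rightarrow> nat \<Rightarrow> real"

definition id_mat :: imat where
  "id_mat i j = (if i = j then 1 else 0)"

definition ones :: "nat \<Rightarrow> real" where
  "ones = (\<lambda>_. 1)"

definition mat_vec :: "imat \<Rightarrow> (nat \<Rightarrow> real) \<Rightarrow> nat \<Rightarrow> real" where
  "mat_vec A x i = (\<Sum>j. A i j * x j)"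

definition mat_mult :: "imat \<Rightarrow> imat \<Rightarrow> imat" (infixl "\<odot>" 70) where
  "(A \<odot> B) i j = (\<Sum>k. A i k * B k j)"

text \<open>The series defining the entries of the product converge. For matrices in
  \<open>L_inf\<close> this is automatic; it is needed for arbitrary nonnegative matrices, because
  \<^const>\<open>suminf\<close> has no meaningful value on divergent series.\<close>

definition mult_defined :: "imat \<Rightarrow> imat \<Rightarrow> bool" where
  "mult_defined A B \<longleftrightarrow> (\<forall>i j. summable (\<lambda>k. A i k * B k j))"


text \<open>The matrices that define a bounded operator on the bounded sequences, where \<open>M\<close> runs over
  the upper bounds of the sup norm of \<open>x\<close>.\<close>

definition L_inf :: "imat set" where
  "L_inf = {A. \<exists>C. \<forall>x M. (\<forall>j. \<bar>x j\<bar> \<le> M) \<longrightarrow>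
      (\<forall>i. summable (\<lambda>j. A i j * x j) \<and> \<bar>mat_vec A x i\<bar> \<le> C * M)}"

text \<open>Meaningful on \<^const>\<open>L_inf\<close> only, where the row sums are bounded.\<close>

definition norm_inf :: "imat \<Rightarrow> real" where
  "norm_inf A = (SUP i. \<Sum>j. \<bar>A i j\<bar>)"

definition is_inverse_mat :: "imat \<Rightarrow> imat \<Rightarrow> bool" where
  "is_inverse_mat M N \<longleftrightarrow> N \<in> L_inf \<and> M \<odot> N = id_mat \<and> N \<odot> M = id_mat"

definition invertible_L_inf :: "imat \<Rightarrow> bool" where
  "invertible_L_inf M \<longleftrightarrow> M \<in> L_inf \<and> (\<exists>N. is_inverse_mat M N)"

definition inv_mat :: "imat \<Rightarrow> imat" where
  "inv_mat M = (THE N. is_inverse_mat M N)"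


text \<open>A function in the Wiener class is represented by its Laurent coefficients. Real coefficients
  suffice, since all matrices involved are real.\<close>

definition wiener :: "(int \<Rightarrow> real) set" where
  "wiener = {f. (\<lambda>i. \<bar>f i\<bar>) summable_on UNIV}"

definition toeplitz :: "(int \<Rightarrow> real) \<Rightarrow> imat" where
  "toeplitz f i j = f (int j - int i)"

definition QT :: "imat set" where
  "QT = {toeplitz f + E | f E. f \<in> wiener \<and> E \<in> L_inf \<and> (\<lambda>i. \<Sum>j. \<bar>E i j\<bar>) \<longlonglongrightarrow> 0}"


definition qbd_block :: "(int \<Rightarrow> int \<Rightarrow> real) \<Rightarrow> (int \<Rightarrow> int \<Rightarrow> real) \<Rightarrow> int \<Rightarrow> imat" where
  "qbd_block a b i r c =
    (if r = 0 then (if c \<le> 1 then b i (int c) else 0)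
     else if \<bar>int c - int r\<bar> \<le> 1 then a i (int c - int r) else 0)"

definition a_sym :: "(int \<Rightarrow> int \<Rightarrow> real) \<Rightarrow> int \<Rightarrow> real \<Rightarrow> real" where
  "a_sym a i z = a i (-1) * inverse z + a i 0 + a i 1 * z"

definition b_sym :: "(int \<Rightarrow> int \<Rightarrow> real) \<Rightarrow> int \<Rightarrow> real \<Rightarrow> real" where
  "b_sym b i z = b i 0 + b i 1 * z"


text \<open>A triple of coefficients is a family indexed by -1, 0, 1. Solutions are arbitrary
  semi-infinite matrices (not only bounded ones) for which the products in the equation exist.\<close>

definition solves_G :: "(int \<Rightarrow> imat) \<Rightarrow> imat \<Rightarrow> bool" where
  "solves_G A X \<longleftrightarrow>
    mult_defined X X \<and> mult_defined (A 1) (X \<odot> X) \<and> mult_defined (A 0) X \<and>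
    A 1 \<odot> (X \<odot> X) + A 0 \<odot> X + A (-1) = X"

definition solves_R :: "(int \<Rightarrow> imat) \<Rightarrow> imat \<Rightarrow> bool" where
  "solves_R A X \<longleftrightarrow>
    mult_defined X (A 0) \<and> mult_defined X X \<and> mult_defined (X \<odot> X) (A (-1)) \<and>
    A 1 + X \<odot> A 0 + (X \<odot> X) \<odot> A (-1) = X"

definition minimal_nonneg :: "(imat \<Rightarrow> bool) \<Rightarrow> imat \<Rightarrow> bool" where
  "minimal_nonneg S X \<longleftrightarrow> 0 \<le> X \<and> S X \<and> (\<forall>Y. 0 \<le> Y \<and> S Y \<longrightarrow> X \<le> Y)"


definition admissible_perturbation :: "(int \<Rightarrow> imat) \<Rightarrow> (int \<Rightarrow> imat) \<Rightarrow> bool" where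
  "admissible_perturbation A D \<longleftrightarrow>
    (\<forall>i\<in>{-1..1}. D i \<in> QT \<and> 0 \<le> A i + D i) \<and>
    (\<Sum>i=-1..1. mat_vec (A i + D i) ones) = ones"

definition Delta_A :: "(int \<Rightarrow> imat) \<Rightarrow> imat \<Rightarrow> imat" where
  "Delta_A D G = D 1 \<odot> (G \<odot> G) + D 0 \<odot> G + D (-1)"

end

theory Submission
  imports Defs
begin

text \<open>
  Since \<open>G\<close> is substochastic, \<open>A 0 + A 1 \<odot> G\<close> is nonnegative with row sums at most
  \<open>1 - \<theta>\<close>, so the Neumann series gives a nonnegative inverse \<open>N\<close> of \<open>W\<close> of norm at most
  \<open>1 / \<theta>\<close>. Minimality of \<open>G\<close> and \<open>R\<close> yields \<open>R = A 1 \<odot> N\<close>, so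
  \<open>inv_mat W \<odot> R \<odot> W = N \<odot> A 1\<close>, and the drift condition bounds the row sums of this matrix:
  \<open>N (A 1 ones) \<le> \<gamma> N (A (-1) ones) \<le> \<gamma> N (W ones) = \<gamma> ones\<close>.
  Multiplying the perturbation equation by \<open>N\<close> turns it into a fixed point equation with
  contraction factor \<open>norm_inf (N \<odot> A 1)\<close>, and all estimates follow.
\<close>

section \<open>Bounded semi-infinite matrices\<close>

text \<open>Absolute convergence of the iterated series makes \<open>f\<close> absolutely summable
  over all index pairs, where the order of summation is immaterial. The first two conclusions give
  control over columns when only the rows are known.\<close>

lemma suminf_swap:
  fixes f :: "nat \<Rightarrow> nat \<Rightarrow> real"
  assumes rows: "\<And>i. summable (\<lambda>j. \<bar>f i j\<bar>)" and total: "summable (\<lambda>i. \<Sum>j. \<bar>f i j\<bar>)"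
  shows summable_column: "summable (\<lambda>i. \<bar>f i j\<bar>)"
    and summable_column_sums: "summable (\<lambda>j. \<Sum>i. \<bar>f i j\<bar>)"
    and "(\<Sum>i. \<Sum>j. f i j) = (\<Sum>j. \<Sum>i. f i j)"
proof -
  \<comment> \<open>Ordered and unordered sums agree for absolutely summable sequences, so the
    interchange theorem for \<open>infsum\<close> becomes available.\<close>
  have infsum_eq: "infsum g UNIV = suminf g" if "summable (\<lambda>k. \<bar>g k\<bar>)" for g :: "nat \<Rightarrow> real"
    using that
    by (intro infsumI norm_summable_imp_has_sum summable_sums) (auto intro: summable_rabs_cancel)
  have nonneg: "(\<Sum>j. \<bar>f i j\<bar>) \<ge> 0" for i
    by (intro suminf_nonneg rows) auto
  have abs_sum: "(\<lambda>p. norm (case p of (i, j) \<Rightarrow> f i j)) summable_on (UNIV \<times> UNIV)"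
    using rows total nonneg
    by (intro Infinite_Sum.abs_summable_on_Sigma_iff[THEN iffD2])
       (simp add: summable_on_UNIV_nonneg_real_iff infsum_eq)
  then have "(\<lambda>p. norm (case p of (j, i) \<Rightarrow> f i j)) summable_on (UNIV \<times> UNIV)"
    by (subst (asm) summable_on_swap) (simp add: case_prod_unfold)
  from Infinite_Sum.abs_summable_on_Sigma_iff[THEN iffD1, OF this] have cols: "summable (\<lambda>i. \<bar>f i j\<bar>)"
    and col_total: "(\<lambda>j. infsum (\<lambda>i. \<bar>f i j\<bar>) UNIV) summable_on UNIV" for j
    by (auto simp: summable_on_UNIV_nonneg_real_iff infsum_nonneg)
  show "summable (\<lambda>i. \<bar>f i j\<bar>)" for j
    by (rule cols)
  show col_total: "summable (\<lambda>j. \<Sum>i. \<bar>f i j\<bar>)"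
    using summable_on_imp_summable[OF col_total] by (simp add: infsum_eq cols)
  have outer: "summable (\<lambda>i. \<bar>\<Sum>j. f i j\<bar>)"
    by (rule summable_comparison_test'[OF total, of 0]) (simp add: summable_rabs rows)
  have outer': "summable (\<lambda>j. \<bar>\<Sum>i. f i j\<bar>)"
    by (rule summable_comparison_test'[OF col_total, of 0]) (simp add: summable_rabs cols)
  show "(\<Sum>i. \<Sum>j. f i j) = (\<Sum>j. \<Sum>i. f i j)"
    using infsum_swap_banach[OF abs_summable_summable[OF abs_sum]]
    by (simp add: infsum_eq rows cols outer outer')
qed

text \<open>Summability is included because \<open>suminf\<close> of a divergent series carries no
  information. The constant \<open>c\<close> is any upper bound, so estimates compose without taking
  suprema.\<close>

definition row_bounded :: "imat \<Rightarrow> real \<Rightarrow> bool" where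
  "row_bounded A c \<longleftrightarrow> (\<forall>i. summable (\<lambda>j. \<bar>A i j\<bar>) \<and> (\<Sum>j. \<bar>A i j\<bar>) \<le> c)"

lemma row_boundedD:
  assumes "row_bounded A c"
  shows "summable (\<lambda>j. \<bar>A i j\<bar>)" "(\<Sum>j. \<bar>A i j\<bar>) \<le> c"
  using assms by (auto simp: row_bounded_def)

lemma row_bounded_nonneg:
  assumes "row_bounded A c"
  shows "0 \<le> c"
  using row_boundedD[OF assms, of 0] suminf_nonneg[of "\<lambda>j. \<bar>A 0 j\<bar>"] by simp

lemma summable_row_mult_bounded:
  assumes "row_bounded A c" "\<And>j. \<bar>x j\<bar> \<le> M"
  shows "summable (\<lambda>j. \<bar>A i j * x j\<bar>)" "(\<Sum>j. \<bar>A i j * x j\<bar>) \<le> c * M"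
proof -
  have le: "\<bar>A i j * x j\<bar> \<le> \<bar>A i j\<bar> * M" for j
    by (simp add: abs_mult assms(2) mult_left_mono)
  have sum: "summable (\<lambda>j. \<bar>A i j\<bar> * M)"
    by (intro summable_mult2 row_boundedD[OF assms(1)])
  show *: "summable (\<lambda>j. \<bar>A i j * x j\<bar>)"
    by (rule summable_comparison_test'[OF sum, of 0]) (use le in auto)
  have "0 \<le> M"
    using assms(2)[of 0] by simp
  have "(\<Sum>j. \<bar>A i j * x j\<bar>) \<le> (\<Sum>j. \<bar>A i j\<bar> * M)"
    by (rule suminf_le[OF le * sum])
  also have "\<dots> = (\<Sum>j. \<bar>A i j\<bar>) * M"
    by (intro suminf_mult2[symmetric] row_boundedD[OF assms(1)])
  also have "\<dots> \<le> c * M"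
    by (intro mult_right_mono row_boundedD[OF assms(1)] \<open>0 \<le> M\<close>)
  finally show "(\<Sum>j. \<bar>A i j * x j\<bar>) \<le> c * M" .
qed

lemma abs_mat_vec_le:
  assumes "row_bounded A c" "\<And>j. \<bar>x j\<bar> \<le> M"
  shows "summable (\<lambda>j. A i j * x j)" "\<bar>mat_vec A x i\<bar> \<le> c * M"
proof -
  note * = summable_row_mult_bounded[OF assms, of i]
  show "summable (\<lambda>j. A i j * x j)"
    using *(1) by (rule summable_rabs_cancel)
  show "\<bar>mat_vec A x i\<bar> \<le> c * M"
    unfolding mat_vec_def by (rule order_trans[OF summable_rabs[OF *(1)] *(2)])
qed

text \<open>Testing the operator bound on the sign pattern of row \<open>i\<close> yields its
  absolute row sum; the converse is the estimate \<open>abs_mat_vec_le\<close>. From here on,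
  operators are handled through their rows.\<close>

lemma L_inf_iff_row_bounded: "A \<in> L_inf \<longleftrightarrow> (\<exists>c. row_bounded A c)"
proof
  assume "A \<in> L_inf"
  then obtain C where C: "\<And>x M i. (\<And>j. \<bar>x j\<bar> \<le> M) \<Longrightarrow>
      summable (\<lambda>j. A i j * x j) \<and> \<bar>mat_vec A x i\<bar> \<le> C * M"
    unfolding L_inf_def mem_Collect_eq by metis
  have "summable (\<lambda>j. \<bar>A i j\<bar>) \<and> (\<Sum>j. \<bar>A i j\<bar>) \<le> C" for i
    using C[of "\<lambda>j. sgn (A i j)" 1 i]
    by (simp add: mat_vec_def abs_sgn_eq abs_le_iff flip: abs_sgn[of "A i _"])
  then show "\<exists>c. row_bounded A c"
    by (auto simp: row_bounded_def)
next
  assume "\<exists>c. row_bounded A c"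
  then obtain c where "row_bounded A c" ..
  from abs_mat_vec_le[OF this] show "A \<in> L_inf"
    unfolding L_inf_def mem_Collect_eq by (intro exI[of _ c]) auto
qed

lemma row_bounded_imp_L_inf: "row_bounded A c \<Longrightarrow> A \<in> L_inf"
  by (auto simp: L_inf_iff_row_bounded)

lemma norm_inf_le: "row_bounded A c \<Longrightarrow> norm_inf A \<le> c"
  unfolding norm_inf_def by (rule cSUP_least) (auto dest: row_boundedD)

lemma row_bounded_norm_inf:
  assumes "A \<in> L_inf"
  shows "row_bounded A (norm_inf A)"
proof -
  obtain c where c: "row_bounded A c"
    using assms by (auto simp: L_inf_iff_row_bounded)
  then have "bdd_above (range (\<lambda>i. \<Sum>j. \<bar>A i j\<bar>))"
    by (auto simp: bdd_above_def dest: row_boundedD)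
  then show ?thesis
    unfolding row_bounded_def norm_inf_def
    by (auto intro: cSUP_upper row_boundedD[OF c])
qed

lemma norm_inf_nonneg: "A \<in> L_inf \<Longrightarrow> 0 \<le> norm_inf A"
  by (rule row_bounded_nonneg[OF row_bounded_norm_inf])

lemma row_bounded_add:
  assumes "row_bounded A c" "row_bounded B d"
  shows "row_bounded (A + B) (c + d)"
  unfolding row_bounded_def
proof (intro allI conjI)
  fix i
  note A = row_boundedD[OF assms(1), of i] and B = row_boundedD[OF assms(2), of i]
  have sum: "summable (\<lambda>j. \<bar>A i j\<bar> + \<bar>B i j\<bar>)"
    by (intro summable_add A B)
  show *: "summable (\<lambda>j. \<bar>(A + B) i j\<bar>)"
    by (rule summable_comparison_test'[OF sum, of 0]) auto
  have "(\<Sum>j. \<bar>(A + B) i j\<bar>) \<le> (\<Sum>j. \<bar>A i j\<bar> + \<bar>B i j\<bar>)"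
    by (rule suminf_le[OF _ * sum]) auto
  also have "\<dots> = (\<Sum>j. \<bar>A i j\<bar>) + (\<Sum>j. \<bar>B i j\<bar>)"
    by (intro suminf_add[symmetric] A B)
  also have "\<dots> \<le> c + d"
    by (intro add_mono A B)
  finally show "(\<Sum>j. \<bar>(A + B) i j\<bar>) \<le> c + d" .
qed

lemma row_bounded_uminus: "row_bounded A c \<Longrightarrow> row_bounded (- A) c"
  by (simp add: row_bounded_def)

lemma row_bounded_diff:
  "row_bounded A c \<Longrightarrow> row_bounded B d \<Longrightarrow> row_bounded (A - B) (c + d)"
  using row_bounded_add[of A c "- B" d] by (simp add: row_bounded_uminus)

lemma mat_mult_eq_mat_vec: "(A \<odot> B) i j = mat_vec A (\<lambda>k. B k j) i"
  by (simp add: mat_mult_def mat_vec_def)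

lemma entry_le_row_bound:
  assumes "row_bounded A c"
  shows "\<bar>A i j\<bar> \<le> c"
  using sum_le_suminf[OF row_boundedD(1)[OF assms, of i], of "{j}"] row_boundedD(2)[OF assms, of i]
  by simp

text \<open>The inner sums are the entries of \<open>A\<close> times weighted absolute row sums of
  \<open>B\<close>, so the estimate for one matrix applies twice. This supplies the hypotheses of
  \<open>suminf_swap\<close> for products.\<close>

lemma double_row_sums:
  assumes A: "row_bounded A c" and B: "row_bounded B d" and x: "\<And>j. \<bar>x j\<bar> \<le> M"
  shows "summable (\<lambda>j. \<bar>A i k * B k j * x j\<bar>)"
    and "summable (\<lambda>k. \<Sum>j. \<bar>A i k * B k j * x j\<bar>)"
    and "(\<Sum>k. \<Sum>j. \<bar>A i k * B k j * x j\<bar>) \<le> c * (d * M)"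
proof -
  note Bx = summable_row_mult_bounded[OF B x]
  show "summable (\<lambda>j. \<bar>A i k * B k j * x j\<bar>)" for k
    using summable_mult[OF Bx(1)[of k], of "\<bar>A i k\<bar>"] by (simp add: abs_mult mult.assoc)
  \<comment> \<open>The inner series is nonnegative, so the absolute value around the whole product
    is compatible with it and gives the form required by
    \<open>summable_row_mult_bounded\<close>.\<close>
  have eq: "(\<Sum>j. \<bar>A i k * B k j * x j\<bar>) = \<bar>A i k * (\<Sum>j. \<bar>B k j * x j\<bar>)\<bar>" for k
    using suminf_mult[OF Bx(1)[of k], of "\<bar>A i k\<bar>"] suminf_nonneg[OF Bx(1)[of k]]
    by (simp add: abs_mult mult.assoc)
  have bound: "\<bar>\<Sum>j. \<bar>B k j * x j\<bar>\<bar> \<le> d * M" for k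
    using Bx[of k] suminf_nonneg[OF Bx(1)[of k]] by simp
  show "summable (\<lambda>k. \<Sum>j. \<bar>A i k * B k j * x j\<bar>)"
    "(\<Sum>k. \<Sum>j. \<bar>A i k * B k j * x j\<bar>) \<le> c * (d * M)"
    unfolding eq using summable_row_mult_bounded[OF A bound] by auto
qed

lemma mat_vec_mat_mult:
  assumes A: "A \<in> L_inf" and B: "B \<in> L_inf" and x: "\<And>j. \<bar>x j\<bar> \<le> M"
  shows "mat_vec (A \<odot> B) x = mat_vec A (mat_vec B x)"
proof
  fix i
  obtain c d where c: "row_bounded A c" and d: "row_bounded B d"
    using A B by (auto simp: L_inf_iff_row_bounded)
  have sA: "summable (\<lambda>k. A i k * B k j)" for j
    by (rule abs_mat_vec_le[OF c]) (rule entry_le_row_bound[OF d])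
  have sB: "summable (\<lambda>j. B k j * x j)" for k
    by (rule abs_mat_vec_le[OF d x])
  have "mat_vec (A \<odot> B) x i = (\<Sum>j. \<Sum>k. A i k * B k j * x j)"
    by (simp add: mat_vec_def mat_mult_def suminf_mult2[OF sA])
  also have "\<dots> = (\<Sum>k. \<Sum>j. A i k * B k j * x j)"
    by (rule suminf_swap(3)[symmetric, OF double_row_sums(1,2)[OF c d x]])
  also have "\<dots> = mat_vec A (mat_vec B x) i"
    by (simp add: mat_vec_def suminf_mult[OF sB] mult.assoc)
  finally show "mat_vec (A \<odot> B) x i = mat_vec A (mat_vec B x) i" .
qed

lemma row_bounded_mat_mult:
  assumes A: "row_bounded A c" and B: "row_bounded B d"
  shows "row_bounded (A \<odot> B) (c * d)"
  unfolding row_bounded_def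
proof (intro allI conjI)
  fix i
  note s = double_row_sums[OF A B, of "\<lambda>_. 1" 1 i, simplified]
  note sw = suminf_swap[of "\<lambda>k j. A i k * B k j", OF s(1,2)]
  have le: "\<bar>(A \<odot> B) i j\<bar> \<le> (\<Sum>k. \<bar>A i k * B k j\<bar>)" for j
    unfolding mat_mult_def by (rule summable_rabs[OF sw(1)])
  show *: "summable (\<lambda>j. \<bar>(A \<odot> B) i j\<bar>)"
    by (rule summable_comparison_test'[OF sw(2), of 0]) (use le in auto)
  have "(\<Sum>j. \<bar>(A \<odot> B) i j\<bar>) \<le> (\<Sum>j. \<Sum>k. \<bar>A i k * B k j\<bar>)"
    by (rule suminf_le[OF le * sw(2)])
  also have "\<dots> = (\<Sum>k. \<Sum>j. \<bar>A i k * B k j\<bar>)"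
    by (rule suminf_swap(3)[symmetric, of "\<lambda>k j. \<bar>A i k * B k j\<bar>"]) (use s in auto)
  also have "\<dots> \<le> c * d"
    by (rule s)
  finally show "(\<Sum>j. \<bar>(A \<odot> B) i j\<bar>) \<le> c * d" .
qed

section \<open>The normed algebra of bounded matrices\<close>

lemma L_inf_add [simp]: "A \<in> L_inf \<Longrightarrow> B \<in> L_inf \<Longrightarrow> A + B \<in> L_inf"
  by (rule row_bounded_imp_L_inf[OF row_bounded_add[OF row_bounded_norm_inf row_bounded_norm_inf]])

lemma L_inf_diff [simp]: "A \<in> L_inf \<Longrightarrow> B \<in> L_inf \<Longrightarrow> A - B \<in> L_inf"
  by (rule row_bounded_imp_L_inf[OF row_bounded_diff[OF row_bounded_norm_inf row_bounded_norm_inf]])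

lemma L_inf_mat_mult [simp]: "A \<in> L_inf \<Longrightarrow> B \<in> L_inf \<Longrightarrow> A \<odot> B \<in> L_inf"
  by (rule row_bounded_imp_L_inf[OF row_bounded_mat_mult[OF row_bounded_norm_inf row_bounded_norm_inf]])

lemma norm_inf_add: "A \<in> L_inf \<Longrightarrow> B \<in> L_inf \<Longrightarrow> norm_inf (A + B) \<le> norm_inf A + norm_inf B"
  by (intro norm_inf_le row_bounded_add row_bounded_norm_inf)

lemma summable_mat_mult:
  assumes "A \<in> L_inf" "B \<in> L_inf"
  shows "summable (\<lambda>k. A i k * B k j)"
  by (rule abs_mat_vec_le[OF row_bounded_norm_inf[OF assms(1)]])
     (rule entry_le_row_bound[OF row_bounded_norm_inf[OF assms(2)]])

lemma mult_defined_L_inf: "A \<in> L_inf \<Longrightarrow> B \<in> L_inf \<Longrightarrow> mult_defined A B"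
  by (simp add: mult_defined_def summable_mat_mult)

text \<open>Each column of \<open>C\<close> is a bounded vector, so \<open>mat_vec_mat_mult\<close>
  applies columnwise. For unrestricted infinite matrices associativity can fail.\<close>

lemma mat_mult_assoc:
  assumes "A \<in> L_inf" "B \<in> L_inf" "C \<in> L_inf"
  shows "(A \<odot> B) \<odot> C = A \<odot> (B \<odot> C)"
proof (intro ext)
  fix i j
  have "\<bar>C k j\<bar> \<le> norm_inf C" for k
    by (rule entry_le_row_bound[OF row_bounded_norm_inf[OF assms(3)]])
  from mat_vec_mat_mult[OF assms(1,2) this]
  show "((A \<odot> B) \<odot> C) i j = (A \<odot> (B \<odot> C)) i j"
    by (simp add: mat_mult_eq_mat_vec)
qed

lemma mat_mult_distrib:
  assumes "A \<in> L_inf" "B \<in> L_inf" "C \<in> L_inf"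
  shows mat_mult_add_right: "A \<odot> (B + C) = A \<odot> B + A \<odot> C"
    and mat_mult_diff_right: "A \<odot> (B - C) = A \<odot> B - A \<odot> C"
    and mat_mult_add_left: "(A + B) \<odot> C = A \<odot> C + B \<odot> C"
    and mat_mult_diff_left: "(A - B) \<odot> C = A \<odot> C - B \<odot> C"
  using assms
  by (simp_all add: fun_eq_iff mat_mult_def distrib_left distrib_right left_diff_distrib
      right_diff_distrib suminf_add suminf_diff summable_mat_mult)

lemmas mat_ring = mat_mult_assoc mat_mult_distrib

lemma mat_mult_id [simp]: "id_mat \<odot> A = A" "A \<odot> id_mat = A"
proof -
  have "(\<Sum>k. id_mat i k * A k j) = (\<Sum>k\<in>{i}. id_mat i k * A k j)" for i j
    by (rule suminf_finite) (auto simp: id_mat_def)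
  then show "id_mat \<odot> A = A"
    by (auto simp: fun_eq_iff mat_mult_def id_mat_def)
  have "(\<Sum>k. A i k * id_mat k j) = (\<Sum>k\<in>{j}. A i k * id_mat k j)" for i j
    by (rule suminf_finite) (auto simp: id_mat_def)
  then show "A \<odot> id_mat = A"
    by (auto simp: fun_eq_iff mat_mult_def id_mat_def)
qed

lemma row_bounded_id_mat: "row_bounded id_mat 1"
proof -
  have "summable (\<lambda>j. \<bar>id_mat i j\<bar>)" for i
    by (rule summable_finite[of "{i}"]) (auto simp: id_mat_def)
  moreover have "(\<Sum>j. \<bar>id_mat i j\<bar>) = (\<Sum>j\<in>{i}. \<bar>id_mat i j\<bar>)" for i
    by (rule suminf_finite) (auto simp: id_mat_def)
  ultimately show ?thesis
    by (simp add: row_bounded_def id_mat_def)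
qed

lemma L_inf_id_mat [simp]: "id_mat \<in> L_inf"
  by (rule row_bounded_imp_L_inf[OF row_bounded_id_mat])

text \<open>Uniqueness of two-sided inverses makes the definite description in
  \<open>inv_mat\<close> meaningful; boundedness enters through associativity.\<close>

lemma inv_mat_eq:
  assumes "M \<in> L_inf" "is_inverse_mat M N"
  shows "inv_mat M = N"
  unfolding inv_mat_def
proof (rule the_equality)
  fix N' assume N': "is_inverse_mat M N'"
  have "N' = N' \<odot> (M \<odot> N)"
    using assms by (simp add: is_inverse_mat_def)
  also have "\<dots> = (N' \<odot> M) \<odot> N"
    using assms N' by (intro mat_mult_assoc[symmetric]) (auto simp: is_inverse_mat_def)
  also have "\<dots> = N"
    using N' by (simp add: is_inverse_mat_def)
  finally show "N' = N" .
qed fact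

text \<open>Row \<open>i\<close> of \<open>toeplitz f\<close> lists distinct Laurent coefficients,
  so its absolute sum is at most the Wiener norm of \<open>f\<close>, uniformly in
  \<open>i\<close>.\<close>

lemma QT_subset_L_inf: "QT \<subseteq> L_inf"
proof
  fix A assume "A \<in> QT"
  then obtain f E where f: "f \<in> wiener" and E: "E \<in> L_inf" and A: "A = toeplitz f + E"
    by (auto simp: QT_def)
  have abs_f: "(\<lambda>i. \<bar>f i\<bar>) summable_on UNIV"
    using f by (simp add: wiener_def)
  have "summable (\<lambda>j. \<bar>toeplitz f i j\<bar>) \<and> (\<Sum>j. \<bar>toeplitz f i j\<bar>) \<le> infsum (\<lambda>k. \<bar>f k\<bar>) UNIV" for i
  proof -
    let ?s = "\<lambda>j. int j - int i"
    have inj: "inj ?s"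
      by (auto simp: inj_on_def)
    have "(\<lambda>k. \<bar>f k\<bar>) summable_on range ?s"
      by (rule summable_on_subset_banach[OF abs_f]) auto
    then have on: "(\<lambda>j. \<bar>f (?s j)\<bar>) summable_on UNIV"
      by (subst (asm) summable_on_reindex[OF inj]) (simp add: o_def)
    have "infsum (\<lambda>j. \<bar>f (?s j)\<bar>) UNIV = infsum (\<lambda>k. \<bar>f k\<bar>) (range ?s)"
      by (subst infsum_reindex[OF inj]) (simp add: o_def)
    also have "\<dots> \<le> infsum (\<lambda>k. \<bar>f k\<bar>) UNIV"
      by (rule infsum_mono_neutral[OF summable_on_subset_banach[OF abs_f] abs_f]) auto
    finally show ?thesis
      using on has_sum_imp_sums[OF has_sum_infsum[OF on]] 
      by (auto simp: toeplitz_def sums_iff)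
  qed
  then have "toeplitz f \<in> L_inf"
    by (auto simp: L_inf_iff_row_bounded row_bounded_def)
  with A E show "A \<in> L_inf"
    by simp
qed


section \<open>Nonnegative matrices\<close>

lemma imat_nonneg_iff: "(0 :: imat) \<le> A \<longleftrightarrow> (\<forall>i j. 0 \<le> A i j)"
  by (simp add: le_fun_def)

lemma mat_vec_mono:
  assumes A: "A \<in> L_inf" "0 \<le> A" and x: "\<And>j. \<bar>x j\<bar> \<le> M" and y: "\<And>j. \<bar>y j\<bar> \<le> M'"
    and le: "\<And>j. x j \<le> y j"
  shows "mat_vec A x i \<le> mat_vec A y i"
  unfolding mat_vec_def
  using abs_mat_vec_le(1)[OF row_bounded_norm_inf[OF A(1)] x]
    abs_mat_vec_le(1)[OF row_bounded_norm_inf[OF A(1)] y] A(2)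
  by (intro suminf_le mult_left_mono le) (auto simp: imat_nonneg_iff)

lemma mat_mult_mono:
  assumes "A \<in> L_inf" "B \<in> L_inf" "A' \<in> L_inf" "B' \<in> L_inf"
    and "0 \<le> A" "0 \<le> B" "A \<le> A'" "B \<le> B'"
  shows "A \<odot> B \<le> A' \<odot> B'"
proof (intro le_funI)
  fix i j
  show "(A \<odot> B) i j \<le> (A' \<odot> B') i j"
    unfolding mat_mult_def
  proof (intro suminf_le summable_mat_mult assms)
    fix k
    have "0 \<le> A i k" "0 \<le> B k j" "A i k \<le> A' i k" "B k j \<le> B' k j"
      using assms(5-8) by (auto simp: le_fun_def)
    then show "A i k * B k j \<le> A' i k * B' k j"
      by (intro mult_mono) auto
  qed
qed

lemma mat_mult_nonneg:
  assumes "A \<in> L_inf" "B \<in> L_inf" "0 \<le> A" "0 \<le> B"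
  shows "0 \<le> A \<odot> B"
  using assms by (auto simp: imat_nonneg_iff mat_mult_def intro!: suminf_nonneg summable_mat_mult)

text \<open>Brings matrices known only as minimal solutions into \<open>L_inf\<close>, by comparison
  with a bounded solution.\<close>

lemma row_bounded_dominated:
  assumes "row_bounded B c" "0 \<le> A" "A \<le> B"
  shows "row_bounded A c"
  unfolding row_bounded_def
proof (intro allI conjI)
  fix i
  have le: "\<bar>A i j\<bar> \<le> \<bar>B i j\<bar>" for j
  proof -
    have "0 \<le> A i j" "A i j \<le> B i j"
      using assms(2,3) by (auto simp: le_fun_def)
    then show ?thesis by simp
  qed
  note B = row_boundedD[OF assms(1), of i]
  show *: "summable (\<lambda>j. \<bar>A i j\<bar>)"
    by (rule summable_comparison_test'[OF B(1), of 0]) (use le in auto)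
  show "(\<Sum>j. \<bar>A i j\<bar>) \<le> c"
    using suminf_le[OF le * B(1)] B(2) by simp
qed

lemma row_bounded_iff_row_sums:
  assumes "A \<in> L_inf" "0 \<le> A"
  shows "row_bounded A c \<longleftrightarrow> (\<forall>i. mat_vec A ones i \<le> c)"
  using row_boundedD(1)[OF row_bounded_norm_inf[OF assms(1)]] assms(2)
  by (simp add: row_bounded_def mat_vec_def ones_def imat_nonneg_iff)

lemma mat_vec_add:
  assumes "A \<in> L_inf" "B \<in> L_inf" "\<And>j. \<bar>x j\<bar> \<le> M"
  shows "mat_vec (A + B) x i = mat_vec A x i + mat_vec B x i"
  using abs_mat_vec_le(1)[OF row_bounded_norm_inf[OF assms(1)] assms(3)]
    abs_mat_vec_le(1)[OF row_bounded_norm_inf[OF assms(2)] assms(3)]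
  by (simp add: mat_vec_def distrib_right suminf_add)

lemma mat_vec_diff:
  assumes "A \<in> L_inf" "B \<in> L_inf" "\<And>j. \<bar>x j\<bar> \<le> M"
  shows "mat_vec (A - B) x i = mat_vec A x i - mat_vec B x i"
  using abs_mat_vec_le(1)[OF row_bounded_norm_inf[OF assms(1)] assms(3)]
    abs_mat_vec_le(1)[OF row_bounded_norm_inf[OF assms(2)] assms(3)]
  by (simp add: mat_vec_def left_diff_distrib suminf_diff)

lemma mat_vec_id [simp]: "mat_vec id_mat x = x"
proof
  fix i
  have "(\<Sum>j. id_mat i j * x j) = (\<Sum>j\<in>{i}. id_mat i j * x j)"
    by (rule suminf_finite) (auto simp: id_mat_def)
  then show "mat_vec id_mat x i = x i"
    by (simp add: mat_vec_def id_mat_def)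
qed

lemma abs_ones_le: "\<bar>ones j\<bar> \<le> 1"
  by (simp add: ones_def)

lemmas row_sums_add = mat_vec_add[where x = ones, OF _ _ abs_ones_le]
lemmas row_sums_diff = mat_vec_diff[where x = ones, OF _ _ abs_ones_le]
lemmas row_sums_mat_mult = mat_vec_mat_mult[where x = ones, OF _ _ abs_ones_le]
lemmas abs_row_sums_le = abs_mat_vec_le(2)[where x = ones, OF row_bounded_norm_inf abs_ones_le]

lemma row_sums_mat_mult_le:
  assumes "A \<in> L_inf" "0 \<le> A" "row_bounded B 1" "0 \<le> B"
  shows "mat_vec (A \<odot> B) ones i \<le> mat_vec A ones i"
proof -
  have B: "B \<in> L_inf"
    by (rule row_bounded_imp_L_inf[OF assms(3)])
  have "mat_vec B ones j \<le> ones j" for j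
    using assms(3) row_bounded_iff_row_sums[OF B assms(4)] by (simp add: ones_def)
  then show ?thesis
    unfolding row_sums_mat_mult[OF assms(1) B]
    by (rule mat_vec_mono[OF assms(1,2) abs_row_sums_le[OF B] abs_ones_le])
qed

text \<open>The powers \<open>Q n\<close> have row bound \<open>q ^ n\<close>, so their entrywise
  sum \<open>N\<close> exists and inherits the geometric bound. Nonnegativity turns absolute entries
  of \<open>N\<close> into sums of absolute entries, which justifies the interchanges of
  summation.\<close>

lemma neumann_series:
  assumes P: "0 \<le> P" "row_bounded P q" and q: "q < 1"
  obtains N where "0 \<le> N" "row_bounded N (1 / (1 - q))" "is_inverse_mat (id_mat - P) N"
proof
  define Q where "Q n = (((\<odot>) P) ^^ n) id_mat" for n
  define N where "N i j = (\<Sum>n. Q n i j)" for i j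
  have PL: "P \<in> L_inf"
    by (rule row_bounded_imp_L_inf[OF P(2)])
  have q0: "0 \<le> q"
    by (rule row_bounded_nonneg[OF P(2)])
  have Q_0: "Q 0 = id_mat" and Q_Suc: "Q (Suc n) = P \<odot> Q n" for n
    by (simp_all add: Q_def)
  have Q_bound: "row_bounded (Q n) (q ^ n)" for n
    by (induction n) (auto simp: Q_0 Q_Suc intro!: row_bounded_id_mat row_bounded_mat_mult P)
  have QL: "Q n \<in> L_inf" for n
    by (rule row_bounded_imp_L_inf[OF Q_bound])
  have Q_nonneg: "0 \<le> Q n" for n
  proof (induction n)
    case 0
    show ?case by (simp add: Q_0 id_mat_def le_fun_def)
  next
    case (Suc n)
    then show ?case unfolding Q_Suc by (intro mat_mult_nonneg PL QL P)
  qed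
  \<comment> \<open>The powers commute with \<open>P\<close>. This form is used for
    \<open>N \<odot> P\<close>, which needs its own computation because a one-sided inverse of an
    infinite matrix need not be two-sided.\<close>
  have Q_Suc': "Q (Suc n) = Q n \<odot> P" for n
  proof (induction n)
    case 0
    show ?case by (simp add: Q_0 Q_Suc)
  next
    case (Suc n)
    have "Q (Suc (Suc n)) = P \<odot> (Q n \<odot> P)"
      unfolding Q_Suc[of "Suc n"] Suc.IH ..
    also have "\<dots> = Q (Suc n) \<odot> P"
      by (simp add: Q_Suc mat_mult_assoc PL QL)
    finally show ?case .
  qed
  have geom: "summable (\<lambda>n. q ^ n)" and geom_sum: "(\<Sum>n. q ^ n) = 1 / (1 - q)"
    using q q0 by (auto intro: suminf_geometric)
  have Q_le: "\<bar>Q n i j\<bar> \<le> q ^ n" for n i j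
    by (rule entry_le_row_bound[OF Q_bound])
  have Q_summable: "summable (\<lambda>n. \<bar>Q n i j\<bar>)" for i j
    by (rule summable_comparison_test'[OF geom, of 0]) (use Q_le in auto)
  note Q_summable' = summable_rabs_cancel[OF Q_summable]
  have N_Suc: "N i j = id_mat i j + (\<Sum>n. Q (Suc n) i j)" for i j
    using suminf_split_head[OF Q_summable', of i j] by (simp add: N_def Q_0)
  show N_nonneg: "0 \<le> N"
    using Q_nonneg by (auto simp: imat_nonneg_iff N_def intro!: suminf_nonneg Q_summable')
  have N_abs: "\<bar>N i j\<bar> = (\<Sum>n. \<bar>Q n i j\<bar>)" for i j
    using N_nonneg Q_nonneg by (simp add: N_def imat_nonneg_iff)
  show N_bound: "row_bounded N (1 / (1 - q))"
    unfolding row_bounded_def N_abs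
  proof (intro allI conjI)
    fix i
    note Qi = row_boundedD[OF Q_bound, of _ i]
    have total: "summable (\<lambda>n. \<Sum>j. \<bar>Q n i j\<bar>)"
      by (rule summable_comparison_test'[OF geom, of 0]) (use Qi in \<open>auto simp: suminf_nonneg\<close>)
    show "summable (\<lambda>j. \<Sum>n. \<bar>Q n i j\<bar>)"
      by (rule summable_column_sums[OF Qi(1) total])
    have "(\<Sum>j. \<Sum>n. \<bar>Q n i j\<bar>) = (\<Sum>n. \<Sum>j. \<bar>Q n i j\<bar>)"
      by (rule suminf_swap(3)[symmetric]) (use Qi(1) total in auto)
    also have "\<dots> \<le> 1 / (1 - q)"
      unfolding geom_sum[symmetric] by (rule suminf_le[OF Qi(2) total geom])
    finally show "(\<Sum>j. \<Sum>n. \<bar>Q n i j\<bar>) \<le> 1 / (1 - q)" .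
  qed
  have NL: "N \<in> L_inf"
    by (rule row_bounded_imp_L_inf[OF N_bound])
  have "(P \<odot> N) i j = (\<Sum>n. Q (Suc n) i j)" for i j
  proof -
    have rows: "summable (\<lambda>n. \<bar>P i k * Q n k j\<bar>)" for k
      unfolding abs_mult by (intro summable_mult Q_summable)
    have "(\<Sum>n. \<bar>P i k * Q n k j\<bar>) = \<bar>P i k * N k j\<bar>" for k
      by (simp add: abs_mult N_abs suminf_mult[OF Q_summable])
    then have total: "summable (\<lambda>k. \<Sum>n. \<bar>P i k * Q n k j\<bar>)"
      using summable_row_mult_bounded(1)[OF P(2) entry_le_row_bound[OF N_bound]] by simp
    have "(P \<odot> N) i j = (\<Sum>k. \<Sum>n. P i k * Q n k j)"
      by (simp add: mat_mult_def N_def suminf_mult[OF Q_summable'])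
    also have "\<dots> = (\<Sum>n. \<Sum>k. P i k * Q n k j)"
      by (rule suminf_swap(3)[OF rows total])
    finally show ?thesis
      by (simp add: Q_Suc mat_mult_def)
  qed
  then have right: "(id_mat - P) \<odot> N = id_mat"
    by (simp add: mat_mult_diff_left PL NL fun_eq_iff N_Suc)
  have "(N \<odot> P) i j = (\<Sum>n. Q (Suc n) i j)" for i j
  proof -
    note s = summable_row_mult_bounded[OF Q_bound entry_le_row_bound[OF P(2)]]
    have total: "summable (\<lambda>n. \<Sum>k. \<bar>Q n i k * P k j\<bar>)"
      by (rule summable_comparison_test'[OF summable_mult2[OF geom, of q], of 0])
         (use s in \<open>auto simp: suminf_nonneg\<close>)
    have "(N \<odot> P) i j = (\<Sum>k. \<Sum>n. Q n i k * P k j)"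
      by (simp add: mat_mult_def N_def suminf_mult2[OF Q_summable'])
    also have "\<dots> = (\<Sum>n. \<Sum>k. Q n i k * P k j)"
      by (rule suminf_swap(3)[symmetric, OF s(1) total])
    finally show ?thesis
      by (simp add: Q_Suc' mat_mult_def)
  qed
  then have "N \<odot> (id_mat - P) = id_mat"
    by (simp add: mat_mult_diff_right PL NL fun_eq_iff N_Suc)
  with right NL show "is_inverse_mat (id_mat - P) N"
    by (simp add: is_inverse_mat_def)
qed

section \<open>Substochastic solutions by monotone iteration\<close>

text \<open>Entries of a product are infinite series, so entrywise convergence of the factors does
  not suffice. The rows of \<open>C\<close> times \<open>M\<close> form a summable majorant, and
  dominated convergence for series applies.\<close>

lemma mat_mult_tendsto:
  assumes A: "\<And>i j. (\<lambda>n. A n i j) \<longlonglongrightarrow> A' i j" and B: "\<And>i j. (\<lambda>n. B n i j) \<longlonglongrightarrow> B' i j"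
    and dom: "C \<in> L_inf" "\<And>n i j. \<bar>A n i j\<bar> \<le> \<bar>C i j\<bar>" and bound: "\<And>n i j. \<bar>B n i j\<bar> \<le> M"
  shows "(\<lambda>n. (A n \<odot> B n) i j) \<longlonglongrightarrow> (A' \<odot> B') i j"
proof -
  have "norm (A n i k * B n k j) \<le> \<bar>C i k\<bar> * M" for k n
    unfolding real_norm_def abs_mult by (intro mult_mono dom bound) auto
  then have "eventually (\<lambda>(k, n). norm (A n i k * B n k j) \<le> \<bar>C i k\<bar> * M) (at_top \<times>\<^sub>F sequentially)"
    by (intro always_eventually) auto
  moreover have "summable (\<lambda>k. \<bar>C i k\<bar> * M)"
    by (intro summable_mult2 row_boundedD(1)[OF row_bounded_norm_inf] dom)
  moreover have "(\<lambda>n. A n i k * B n k j) \<longlonglongrightarrow> A' i k * B' k j" for k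
    by (intro tendsto_mult A B)
  ultimately show ?thesis
    unfolding mat_mult_def
    using tannerys_theorem[of "\<lambda>k n. A n i k * B n k j" "\<lambda>k. A' i k * B' k j" sequentially
        "\<lambda>k. \<bar>C i k\<bar> * M"]
    by simp
qed

text \<open>The map \<open>F\<close> is monotone and preserves nonnegative substochastic matrices,
  so its iterates from \<open>0\<close> increase entrywise to a limit, which is a fixed
  point.\<close>

lemma substochastic_solution_exists:
  assumes L: "A 1 \<in> L_inf" "A 0 \<in> L_inf" "A (-1) \<in> L_inf"
    and nonneg: "0 \<le> A 1" "0 \<le> A 0" "0 \<le> A (-1)"
    and sums: "\<And>i. mat_vec (A 1) ones i + mat_vec (A 0) ones i + mat_vec (A (-1)) ones i \<le> 1"
  shows "\<exists>X. 0 \<le> X \<and> row_bounded X 1 \<and> solves_G A X"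
proof -
  define F where "F X = A 1 \<odot> (X \<odot> X) + A 0 \<odot> X + A (-1)" for X
  define X where "X n = (F ^^ n) 0" for n
  have X_0: "X 0 = 0" and X_Suc: "X (Suc n) = F (X n)" for n
    by (simp_all add: X_def)
  have F: "0 \<le> F Y \<and> row_bounded (F Y) 1" if Y: "0 \<le> Y" "row_bounded Y 1" for Y
  proof
    have YL: "Y \<in> L_inf"
      by (rule row_bounded_imp_L_inf[OF Y(2)])
    have YY: "0 \<le> Y \<odot> Y" "row_bounded (Y \<odot> Y) 1"
      using mat_mult_nonneg[OF YL YL Y(1) Y(1)] row_bounded_mat_mult[OF Y(2) Y(2)] by auto
    show "0 \<le> F Y"
      unfolding F_def by (intro add_nonneg_nonneg mat_mult_nonneg L nonneg YL Y L_inf_mat_mult)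
    moreover have "mat_vec (F Y) ones i \<le> 1" for i
      using row_sums_mat_mult_le[OF L(1) nonneg(1) YY(2,1), of i]
        row_sums_mat_mult_le[OF L(2) nonneg(2) Y(2,1), of i] sums[of i]
      by (simp add: F_def row_sums_add L YL)
    ultimately show "row_bounded (F Y) 1"
      by (subst row_bounded_iff_row_sums) (auto simp: F_def L YL)
  qed
  have "row_bounded (0 :: imat) 1"
    by (simp add: row_bounded_def)
  then have X: "0 \<le> X n \<and> row_bounded (X n) 1" for n
    by (induction n) (simp_all add: X_0 X_Suc F)
  then have X_nonneg: "0 \<le> X n" and X_bound: "row_bounded (X n) 1" for n
    by auto
  have XL: "X n \<in> L_inf" for n
    by (rule row_bounded_imp_L_inf[OF X_bound])
  have mono: "X n \<le> X (Suc n)" for n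
  proof (induction n)
    case 0
    show ?case unfolding X_0 by (rule X_nonneg)
  next
    case (Suc n)
    then show ?case
      unfolding X_Suc[of "Suc n"] X_Suc[of n] F_def
      by (intro add_mono mat_mult_mono L_inf_mat_mult mat_mult_nonneg L nonneg order_refl
          XL X_nonneg; simp add: X_Suc[of n, symmetric] XL X_nonneg flip: F_def)
  qed
  have inc: "incseq (\<lambda>n. X n i j)" for i j
    using mono by (intro incseq_SucI) (auto simp: le_fun_def)
  have "\<exists>l. (\<lambda>n. X n i j) \<longlonglongrightarrow> l \<and> (\<forall>n. X n i j \<le> l)" for i j
  proof -
    have "\<forall>n. X n i j \<le> 1"
      using entry_le_row_bound[OF X_bound] by (simp add: abs_le_iff)
    then show ?thesis
      using incseq_convergent[OF inc] by blast
  qed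
  then obtain Y where lim: "\<And>i j. (\<lambda>n. X n i j) \<longlonglongrightarrow> Y i j" and le: "\<And>n i j. X n i j \<le> Y i j"
    by metis
  have X_pos: "0 \<le> X n i j" for n i j
    using X_nonneg by (auto simp: le_fun_def)
  have Y_pos: "0 \<le> Y i j" for i j
    using X_pos le by (rule order_trans)
  \<comment> \<open>Infinite row sums need not pass to entrywise limits, so the bound is carried
    over to finite partial sums first.\<close>
  have "(\<Sum>j<m. Y i j) \<le> 1" for i m
  proof (rule LIMSEQ_le_const2)
    show "(\<lambda>n. \<Sum>j<m. X n i j) \<longlonglongrightarrow> (\<Sum>j<m. Y i j)"
      by (intro tendsto_sum lim)
    have "(\<Sum>j<m. X n i j) \<le> 1" for n
      using sum_le_suminf[OF row_boundedD(1)[OF X_bound[of n], of i], of "{..<m}"]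
        row_boundedD(2)[OF X_bound[of n], of i] X_pos by simp
    then show "\<exists>N. \<forall>n\<ge>N. (\<Sum>j<m. X n i j) \<le> 1"
      by auto
  qed
  then have Y_bound: "row_bounded Y 1"
    unfolding row_bounded_def using Y_pos
    by (auto intro!: summableI_nonneg_bounded suminf_le_const)
  then have YL: "Y \<in> L_inf"
    by (rule row_bounded_imp_L_inf)
  \<comment> \<open>The left factors vary with \<open>n\<close>; the limit \<open>Y\<close>
    dominates them because the iterates increase.\<close>
  have XX: "(\<lambda>n. (X n \<odot> X n) i j) \<longlonglongrightarrow> (Y \<odot> Y) i j" for i j
  proof (rule mat_mult_tendsto[OF lim lim YL])
    show "\<bar>X n i j\<bar> \<le> \<bar>Y i j\<bar>" for n i j
      using le[of n i j] X_pos[of n i j] by simp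
  qed (rule entry_le_row_bound[OF X_bound])
  \<comment> \<open>Here the left factors are constant and dominate themselves.\<close>
  have "(\<lambda>n. F (X n) i j) \<longlonglongrightarrow> F Y i j" for i j
    unfolding F_def plus_fun_apply
    by (intro tendsto_add tendsto_const mat_mult_tendsto[where C = "A 1" and M = "1 * 1"]
        mat_mult_tendsto[where C = "A 0" and M = 1] L XX lim order_refl
        entry_le_row_bound[OF X_bound] entry_le_row_bound[OF row_bounded_mat_mult[OF X_bound X_bound]])
  then have "(\<lambda>n. X (Suc n) i j) \<longlonglongrightarrow> F Y i j" for i j
    by (simp add: X_Suc)
  then have "F Y = Y"
    using LIMSEQ_Suc[OF lim] LIMSEQ_unique by (intro ext) blast
  then have "solves_G A Y"
    using L YL by (simp add: solves_G_def mult_defined_L_inf F_def)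
  with Y_bound Y_pos show ?thesis
    by (auto simp: imat_nonneg_iff)
qed

text \<open>The minimal solution lies below the substochastic one just constructed. This serves the
  original and the perturbed coefficients alike.\<close>

lemma minimal_solution_row_bounded:
  assumes "A 1 \<in> L_inf" "A 0 \<in> L_inf" "A (-1) \<in> L_inf"
    and "0 \<le> A 1" "0 \<le> A 0" "0 \<le> A (-1)"
    and "\<And>i. mat_vec (A 1) ones i + mat_vec (A 0) ones i + mat_vec (A (-1)) ones i \<le> 1"
    and "minimal_nonneg (solves_G A) G"
  shows "row_bounded G 1"
  using substochastic_solution_exists[of A, OF assms(1-7)] assms(8)
  unfolding minimal_nonneg_def by (blast intro: row_bounded_dominated)

text \<open>Multiplication by \<open>N\<close> gives
  \<open>E = N \<odot> H + (N \<odot> B) \<odot> (E \<odot> Y)\<close>. The second term has norm at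
  most \<open>g * norm_inf E\<close> and is absorbed on the left since \<open>g < 1\<close>.\<close>

lemma norm_bound_of_linear_equation:
  assumes inv: "is_inverse_mat M N" and L: "M \<in> L_inf" "B \<in> L_inf" "E \<in> L_inf" "H \<in> L_inf"
    and Y: "row_bounded Y 1" and NB: "row_bounded (N \<odot> B) g" "g < 1" and N: "row_bounded N c"
    and eq: "M \<odot> E - B \<odot> E \<odot> Y = H"
  shows "norm_inf E \<le> c / (1 - g) * norm_inf H"
proof -
  have YL: "Y \<in> L_inf" and NL: "N \<in> L_inf"
    using Y N by (auto intro: row_bounded_imp_L_inf)
  have "N \<odot> H = (N \<odot> M) \<odot> E - (N \<odot> B) \<odot> (E \<odot> Y)"
    using L YL NL by (simp add: eq[symmetric] mat_ring)
  then have "E = N \<odot> H + (N \<odot> B) \<odot> (E \<odot> Y)"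
    using inv by (simp add: is_inverse_mat_def)
  moreover have "row_bounded (N \<odot> H + (N \<odot> B) \<odot> (E \<odot> Y)) (c * norm_inf H + g * (norm_inf E * 1))"
    by (intro row_bounded_add row_bounded_mat_mult N NB Y row_bounded_norm_inf L)
  ultimately have "norm_inf E \<le> c * norm_inf H + g * norm_inf E"
    using norm_inf_le by fastforce
  then show ?thesis
    using NB(2) by (simp add: field_simps)
qed


section \<open>The quasi-birth-death problem with negative drift\<close>

lemma qbd_block_row:
  assumes "\<And>j. j \<in> {-1..1} \<Longrightarrow> 0 \<le> a i j" "\<And>j. j \<in> {0..1} \<Longrightarrow> 0 \<le> b i j"
  shows "0 \<le> qbd_block a b i" and "qbd_block a b i \<in> L_inf"
    and "mat_vec (qbd_block a b i) ones r = (if r = 0 then b_sym b i 1 else a_sym a i 1)"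
proof -
  let ?A = "qbd_block a b i"
  show nonneg: "0 \<le> ?A"
    using assms by (auto simp: imat_nonneg_iff qbd_block_def abs_le_iff)
  \<comment> \<open>For \<open>r = 0\<close> the truncated difference \<open>r - 1\<close> is
    \<open>0\<close>, so the same interval also covers the two entries of the boundary row.\<close>
  have zero: "?A r c = 0" if "c \<notin> {r - 1..Suc r}" for r c
    using that by (auto simp: qbd_block_def)
  have summable: "summable (\<lambda>c. ?A r c)" for r
    by (rule summable_finite[OF finite_atLeastAtMost zero])
  have sum: "(\<Sum>c. ?A r c) = (if r = 0 then b_sym b i 1 else a_sym a i 1)" for r
  proof -
    have "(\<Sum>c. ?A r c) = (\<Sum>c\<in>{r - 1..Suc r}. ?A r c)"
      by (rule suminf_finite[OF finite_atLeastAtMost zero])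
    also have "\<dots> = (if r = 0 then b_sym b i 1 else a_sym a i 1)"
    proof (cases r)
      case 0
      have "{0..Suc 0} = {0, Suc 0}"
        by auto
      with 0 show ?thesis
        by (simp add: qbd_block_def b_sym_def)
    next
      case (Suc m)
      have "{m..Suc (Suc m)} = {m, Suc m, Suc (Suc m)}"
        by auto
      with Suc show ?thesis
        by (simp add: qbd_block_def a_sym_def)
    qed
    finally show ?thesis .
  qed
  show "mat_vec ?A ones r = (if r = 0 then b_sym b i 1 else a_sym a i 1)"
    using sum by (simp add: mat_vec_def ones_def)
  have "row_bounded ?A (max (b_sym b i 1) (a_sym a i 1))"
    unfolding row_bounded_def using nonneg summable sum by (simp add: le_fun_def)
  then show "?A \<in> L_inf"
    by (rule row_bounded_imp_L_inf)
qed

lemma sum_minus_one_to_one: "(\<Sum>i=-1..1. f i) = f (-1) + f 0 + f (1 :: int)"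
proof -
  have "{-1..1} = {-1, 0, 1 :: int}"
    by auto
  then show ?thesis
    by (simp add: add.assoc)
qed

text \<open>Only sign, boundedness and row sums of the blocks are kept, so the tridiagonal structure
  is abstracted away. The condition \<open>\<gamma> < 1\<close> is added where a contraction is
  needed.\<close>

locale drifted_qbd =
  fixes A :: "int \<Rightarrow> imat" and \<theta> \<gamma> :: real
  assumes nonneg: "0 \<le> A 1" "0 \<le> A 0" "0 \<le> A (-1)"
    and in_L_inf: "A 1 \<in> L_inf" "A 0 \<in> L_inf" "A (-1) \<in> L_inf"
    and row_sums: "\<And>i. mat_vec (A 1) ones i + mat_vec (A 0) ones i + mat_vec (A (-1)) ones i = 1"
    and theta_pos: "0 < \<theta>" and theta_le: "\<And>i. \<theta> \<le> mat_vec (A (-1)) ones i"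
    and gamma_nonneg: "0 \<le> \<gamma>"
    and gamma_drift: "\<And>i. mat_vec (A 1) ones i \<le> \<gamma> * mat_vec (A (-1)) ones i"
begin

text \<open>Stated for every substochastic \<open>X\<close>, because it is applied to the perturbed
  solution \<open>G + E\<close> as well as to \<open>G\<close>.\<close>

lemma inverse_bounds:
  assumes X: "0 \<le> X" "row_bounded X 1"
  obtains N where "0 \<le> N" "row_bounded N (1 / \<theta>)"
    "is_inverse_mat (id_mat - A 0 - A 1 \<odot> X) N" "row_bounded (N \<odot> A 1) \<gamma>"
proof -
  define P where "P = A 0 + A 1 \<odot> X"
  define M where "M = id_mat - P"
  have XL: "X \<in> L_inf"
    by (rule row_bounded_imp_L_inf[OF X(2)])
  have PL: "P \<in> L_inf" and M_in: "M \<in> L_inf"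
    by (simp_all add: P_def M_def in_L_inf XL)
  have P_nonneg: "0 \<le> P"
    unfolding P_def by (intro add_nonneg_nonneg mat_mult_nonneg nonneg in_L_inf XL X)
  have P_sums: "mat_vec P ones i \<le> 1 - mat_vec (A (-1)) ones i" for i
    using row_sums_mat_mult_le[OF in_L_inf(1) nonneg(1) X(2,1), of i] row_sums[of i]
    by (simp add: P_def row_sums_add in_L_inf XL)
  have "mat_vec P ones i \<le> 1 - \<theta>" for i
    using P_sums[of i] theta_le[of i] by simp
  then have "row_bounded P (1 - \<theta>)"
    by (simp add: row_bounded_iff_row_sums PL P_nonneg)
  with theta_pos obtain N where N: "0 \<le> N" "row_bounded N (1 / \<theta>)" "is_inverse_mat M N"
    using neumann_series[OF P_nonneg, of "1 - \<theta>"] by (auto simp: M_def)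
  have NL: "N \<in> L_inf"
    by (rule row_bounded_imp_L_inf[OF N(2)])
  \<comment> \<open>The row sums of \<open>P\<close> and \<open>A (-1)\<close> add up to at most 1.
    Hence the drift can be compared with \<open>M ones\<close>, which \<open>N\<close> maps back to
    \<open>ones\<close>.\<close>
  have M_sums: "mat_vec (A (-1)) ones i \<le> mat_vec M ones i" for i
    using P_sums[of i] by (simp add: M_def row_sums_diff PL ones_def[THEN fun_cong])
  have bound: "\<bar>\<gamma> * mat_vec M ones i\<bar> \<le> \<gamma> * norm_inf M" for i
    unfolding abs_mult using abs_row_sums_le[OF M_in, of i] gamma_nonneg
    by (intro mult_mono) auto
  have "mat_vec (N \<odot> A 1) ones i \<le> \<gamma>" for i
  proof -
    have "mat_vec (N \<odot> A 1) ones i = mat_vec N (mat_vec (A 1) ones) i"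
      by (simp add: row_sums_mat_mult NL in_L_inf)
    also have "\<dots> \<le> mat_vec N (\<lambda>j. \<gamma> * mat_vec M ones j) i"
    proof (rule mat_vec_mono[OF NL N(1) abs_row_sums_le[OF in_L_inf(1)] bound])
      fix j
      show "mat_vec (A 1) ones j \<le> \<gamma> * mat_vec M ones j"
        using gamma_drift[of j] mult_left_mono[OF M_sums[of j] gamma_nonneg] by simp
    qed
    also have "\<dots> = \<gamma> * mat_vec N (mat_vec M ones) i"
      using abs_mat_vec_le(1)[OF row_bounded_norm_inf[OF NL] abs_row_sums_le[OF M_in]]
      by (simp add: mat_vec_def[of N] suminf_mult mult.left_commute)
    also have "\<dots> = \<gamma> * mat_vec (N \<odot> M) ones i"
      by (simp add: row_sums_mat_mult NL M_in)
    finally show ?thesis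
      using N(3) by (simp add: is_inverse_mat_def ones_def)
  qed
  then have "row_bounded (N \<odot> A 1) \<gamma>"
    using mat_mult_nonneg[OF NL in_L_inf(1) N(1) nonneg(1)]
    by (simp add: row_bounded_iff_row_sums NL in_L_inf)
  moreover have "M = id_mat - A 0 - A 1 \<odot> X"
    by (simp add: M_def P_def diff_diff_eq)
  ultimately show ?thesis
    using N that by blast
qed

text \<open>Minimality of both solutions enters here: \<open>A 1 \<odot> N\<close> solves the equation for \<open>R\<close>, so it
  dominates \<open>R\<close>; conversely \<open>R\<close> yields the solution \<open>N' \<odot> A (-1)\<close> of the equation
  for \<open>G\<close>, where \<open>N'\<close> is the inverse of \<open>id_mat - A 0 - R \<odot> A (-1)\<close>.\<close>

lemma minimal_R_eq:
  assumes G_min: "minimal_nonneg (solves_G A) G" and R_min: "minimal_nonneg (solves_R A) R"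
    and G_bound: "row_bounded G 1" and N: "0 \<le> N" "is_inverse_mat (id_mat - A 0 - A 1 \<odot> G) N"
  shows "R = A 1 \<odot> N"
proof -
  define W where "W = id_mat - A 0 - A 1 \<odot> G"
  have G: "0 \<le> G" "A 1 \<odot> (G \<odot> G) + A 0 \<odot> G + A (-1) = G"
    using G_min by (auto simp: minimal_nonneg_def solves_G_def)
  have GL: "G \<in> L_inf"
    by (rule row_bounded_imp_L_inf[OF G_bound])
  have NL: "N \<in> L_inf" and NW: "N \<odot> W = id_mat" and WN: "W \<odot> N = id_mat"
    using N by (auto simp: is_inverse_mat_def W_def)
  note L [simp] = in_L_inf GL NL
  have WL [simp]: "W \<in> L_inf"
    by (simp add: W_def)
  \<comment> \<open>The equation for \<open>G\<close> in factored form. Together with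
    \<open>R' \<odot> W = A 1\<close> it gives \<open>R' \<odot> A (-1) = A 1 \<odot> G\<close>,
    which reduces the equation for \<open>R'\<close> to the definition of \<open>W\<close>.\<close>
  have WG: "W \<odot> G = A (-1)"
    using G(2) by (simp add: W_def mat_ring algebra_simps)
  define R' where "R' = A 1 \<odot> N"
  have R'L [simp]: "R' \<in> L_inf"
    by (simp add: R'_def)
  have R'_nonneg: "0 \<le> R'"
    unfolding R'_def by (intro mat_mult_nonneg L nonneg N)
  have R'W: "R' \<odot> W = A 1"
    by (simp add: R'_def mat_mult_assoc NW)
  have R'_A: "R' \<odot> A (-1) = A 1 \<odot> G"
    by (simp add: R'W flip: WG mat_mult_assoc)
  have "R' - R' \<odot> A 0 - R' \<odot> (R' \<odot> A (-1)) = A 1"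
    unfolding R'_A using R'W by (simp add: W_def mat_ring)
  then have "solves_R A R'"
    by (simp add: solves_R_def mult_defined_L_inf mat_mult_assoc algebra_simps)
  then have R_le: "R \<le> R'" and R: "0 \<le> R" "A 1 + R \<odot> A 0 + (R \<odot> R) \<odot> A (-1) = R"
    using R_min R'_nonneg by (auto simp: minimal_nonneg_def solves_R_def)
  have RL [simp]: "R \<in> L_inf"
    using row_bounded_dominated[OF row_bounded_norm_inf[OF R'L] R(1) R_le]
    by (rule row_bounded_imp_L_inf)
  \<comment> \<open>Consequently \<open>P\<close> below is dominated by
    \<open>A 0 + A 1 \<odot> G\<close> and inherits the row bound \<open>1 - \<theta>\<close>
    required for its Neumann series.\<close>
  have RA_le: "R \<odot> A (-1) \<le> A 1 \<odot> G"
    unfolding R'_A[symmetric] by (intro mat_mult_mono L RL R'L nonneg R R_le order_refl)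
  have RA_nonneg: "0 \<le> R \<odot> A (-1)"
    by (intro mat_mult_nonneg RL L R nonneg)
  define P where "P = A 0 + R \<odot> A (-1)"
  have PL [simp]: "P \<in> L_inf"
    by (simp add: P_def)
  have P_nonneg: "0 \<le> P"
    unfolding P_def by (intro add_nonneg_nonneg nonneg RA_nonneg)
  have "mat_vec (A 0 + A 1 \<odot> G) ones i \<le> 1 - \<theta>" for i
    using row_sums_mat_mult_le[OF in_L_inf(1) nonneg(1) G_bound G(1), of i] row_sums[of i]
      theta_le[of i]
    by (simp add: row_sums_add)
  moreover have "0 \<le> A 0 + A 1 \<odot> G"
    by (intro add_nonneg_nonneg mat_mult_nonneg nonneg L G)
  ultimately have "row_bounded (A 0 + A 1 \<odot> G) (1 - \<theta>)"
    by (subst row_bounded_iff_row_sums) auto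
  then have "row_bounded P (1 - \<theta>)"
    by (rule row_bounded_dominated[OF _ P_nonneg]) (unfold P_def, intro add_left_mono RA_le)
  with theta_pos obtain N' where N': "0 \<le> N'" "is_inverse_mat (id_mat - P) N'"
    using neumann_series[OF P_nonneg, of "1 - \<theta>"] by auto
  then have N'L [simp]: "N' \<in> L_inf" and inv': "(id_mat - P) \<odot> N' = id_mat"
    by (auto simp: is_inverse_mat_def)
  have "R \<odot> (id_mat - P) = A 1"
    using R(2) by (simp add: P_def mat_ring algebra_simps)
  then have "(R \<odot> (id_mat - P)) \<odot> N' = A 1 \<odot> N'"
    by simp
  then have R_eq: "R = A 1 \<odot> N'"
    by (simp add: mat_mult_assoc inv')
  \<comment> \<open>As \<open>R = A 1 \<odot> N'\<close>, the matrix \<open>id_mat - P\<close>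
    equals \<open>id_mat - A 0 - A 1 \<odot> G'\<close>; its product with \<open>G'\<close> is
    \<open>A (-1)\<close>, which is the equation for \<open>G\<close>.\<close>
  define G' where "G' = N' \<odot> A (-1)"
  have G'L [simp]: "G' \<in> L_inf"
    by (simp add: G'_def)
  have G'_nonneg: "0 \<le> G'"
    unfolding G'_def by (intro mat_mult_nonneg N'L L N' nonneg)
  have RA: "R \<odot> A (-1) = A 1 \<odot> G'"
    by (simp add: R_eq G'_def mat_mult_assoc)
  have "(id_mat - P) \<odot> G' = A (-1)"
    by (simp add: G'_def inv' flip: mat_mult_assoc)
  then have "solves_G A G'"
    by (simp add: solves_G_def mult_defined_L_inf P_def RA mat_ring algebra_simps)
  then have "G \<le> G'"
    using G_min G'_nonneg by (auto simp: minimal_nonneg_def)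
  \<comment> \<open>This reverses \<open>RA_le\<close>. Equality identifies
    \<open>id_mat - P\<close> with \<open>W\<close>, and uniqueness of the inverse finishes the
    argument.\<close>
  then have "A 1 \<odot> G \<le> R \<odot> A (-1)"
    unfolding RA by (intro mat_mult_mono L G'L nonneg G order_refl)
  then have "A 1 \<odot> G = R \<odot> A (-1)"
    using RA_le by (rule antisym)
  then have "id_mat - P = W"
    by (simp add: P_def W_def diff_diff_eq)
  with N'(2) have "is_inverse_mat W N'"
    by simp
  then have "N' = N"
    using inv_mat_eq[OF WL] N(2)[folded W_def] by metis
  with R_eq show ?thesis
    by simp
qed

section \<open>Linear and quadratic perturbation estimates\<close>

text \<open>Separate matrices \<open>X\<close> and \<open>Y\<close> accommodate the exact difference
  equation, where \<open>X\<close> is \<open>G + E\<close> and \<open>Y\<close> is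
  \<open>G\<close>.\<close>

lemma linear_perturbation_bound:
  assumes X: "0 \<le> X" "row_bounded X 1" and Y: "row_bounded Y 1" and "\<gamma> < 1"
    and L: "E \<in> L_inf" "H \<in> L_inf"
    and eq: "(id_mat - A 0 - A 1 \<odot> X) \<odot> E - A 1 \<odot> E \<odot> Y = H"
  shows "norm_inf E \<le> 1 / (\<theta> * (1 - \<gamma>)) * norm_inf H"
proof -
  obtain N where N: "row_bounded N (1 / \<theta>)" "is_inverse_mat (id_mat - A 0 - A 1 \<odot> X) N"
    "row_bounded (N \<odot> A 1) \<gamma>"
    using inverse_bounds[OF X] by blast
  have "id_mat - A 0 - A 1 \<odot> X \<in> L_inf"
    using row_bounded_imp_L_inf[OF X(2)] by (simp add: in_L_inf)
  from norm_bound_of_linear_equation[OF N(2) this in_L_inf(1) L Y N(3) \<open>\<gamma> < 1\<close> N(1) eq]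
  show ?thesis
    by simp
qed

text \<open>The first relation has no quadratic term, since \<open>G + E\<close> replaces \<open>G\<close> in the left factor. It
  therefore bounds \<open>E\<close> linearly in \<open>D\<close> with no smallness assumption, and the remainder in the
  second relation is quadratic in \<open>D\<close>.\<close>

lemma solution_difference_eq:
  assumes L: "G \<in> L_inf" "E \<in> L_inf" "\<And>i. i \<in> {-1..1} \<Longrightarrow> D i \<in> L_inf"
    and sol: "solves_G A G" "solves_G (\<lambda>i. A i + D i) (G + E)"
  shows "(id_mat - A 0 - A 1 \<odot> (G + E)) \<odot> E - A 1 \<odot> E \<odot> G
      = D 1 \<odot> ((G + E) \<odot> (G + E)) + D 0 \<odot> (G + E) + D (-1)"
    and "(id_mat - A 0 - A 1 \<odot> G) \<odot> E - A 1 \<odot> E \<odot> G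
      = Delta_A D G + (A 1 \<odot> (E \<odot> E) + D 1 \<odot> (G \<odot> E + E \<odot> (G + E)) + D 0 \<odot> E)"
proof -
  have D: "D 1 \<in> L_inf" "D 0 \<in> L_inf" "D (-1) \<in> L_inf"
    using L(3) by auto
  note L' [simp] = L(1,2) D in_L_inf
  have eq: "A 1 \<odot> (G \<odot> G) + A 0 \<odot> G + A (-1) = G"
    "(A 1 + D 1) \<odot> ((G + E) \<odot> (G + E)) + (A 0 + D 0) \<odot> (G + E) + (A (-1) + D (-1)) = G + E"
    using sol by (auto simp: solves_G_def)
  have eq': "(A 1 \<odot> (G \<odot> G)) i j + (A 0 \<odot> G) i j + A (-1) i j = G i j" for i j
    using fun_cong[OF fun_cong[OF eq(1), of i], of j] by simp
  \<comment> \<open>After expansion both equations are linear in entries of products, so each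
    identity becomes arithmetic at a fixed entry.\<close>
  note eq'' = fun_cong[OF fun_cong[OF eq(2)[simplified mat_ring L' L_inf_add L_inf_mat_mult]]]
  show "(id_mat - A 0 - A 1 \<odot> (G + E)) \<odot> E - A 1 \<odot> E \<odot> G
      = D 1 \<odot> ((G + E) \<odot> (G + E)) + D 0 \<odot> (G + E) + D (-1)"
  proof (intro ext)
    fix i j
    show "((id_mat - A 0 - A 1 \<odot> (G + E)) \<odot> E - A 1 \<odot> E \<odot> G) i j
        = (D 1 \<odot> ((G + E) \<odot> (G + E)) + D 0 \<odot> (G + E) + D (-1)) i j"
      using eq'[of i j] eq''[of i j] by (simp add: mat_ring)
  qed
  show "(id_mat - A 0 - A 1 \<odot> G) \<odot> E - A 1 \<odot> E \<odot> G
      = Delta_A D G + (A 1 \<odot> (E \<odot> E) + D 1 \<odot> (G \<odot> E + E \<odot> (G + E)) + D 0 \<odot> E)"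
  proof (intro ext)
    fix i j
    show "((id_mat - A 0 - A 1 \<odot> G) \<odot> E - A 1 \<odot> E \<odot> G) i j
        = (Delta_A D G + (A 1 \<odot> (E \<odot> E) + D 1 \<odot> (G \<odot> E + E \<odot> (G + E)) + D 0 \<odot> E)) i j"
      using eq'[of i j] eq''[of i j] by (simp add: mat_ring Delta_A_def)
  qed
qed

lemma admissible_perturbationD:
  assumes "admissible_perturbation A D"
  shows "i \<in> {-1..1} \<Longrightarrow> D i \<in> L_inf" and "i \<in> {-1..1} \<Longrightarrow> 0 \<le> A i + D i"
    and "mat_vec (A 1 + D 1) ones r + mat_vec (A 0 + D 0) ones r
      + mat_vec (A (-1) + D (-1)) ones r = 1"
proof -
  show "i \<in> {-1..1} \<Longrightarrow> D i \<in> L_inf" and "i \<in> {-1..1} \<Longrightarrow> 0 \<le> A i + D i"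
    using assms QT_subset_L_inf by (auto simp: admissible_perturbation_def)
  have "(\<Sum>i=-1..1. mat_vec (A i + D i) ones) r = ones r"
    using assms by (simp add: admissible_perturbation_def)
  then show "mat_vec (A 1 + D 1) ones r + mat_vec (A 0 + D 0) ones r
      + mat_vec (A (-1) + D (-1)) ones r = 1"
    unfolding sum_minus_one_to_one plus_fun_apply by (simp add: ones_def[THEN fun_cong, of r])
qed

text \<open>The exact equation first gives \<open>e \<le> l * \<delta>\<close>. In the relation for
  \<open>W\<close> the remainder \<open>Q\<close> is then quadratic in \<open>\<delta>\<close>: the
  square of \<open>E\<close> contributes \<open>l\<^sup>2\<close>, the terms with \<open>D 1\<close>
  contribute \<open>2 * l\<close>, and the term with \<open>D 0\<close> contributes
  \<open>l\<close>.\<close>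

lemma quadratic_perturbation_bound:
  assumes "\<gamma> < 1" and G_min: "minimal_nonneg (solves_G A) G"
    and N: "is_inverse_mat (id_mat - A 0 - A 1 \<odot> G) N" "row_bounded (N \<odot> A 1) g" "g < 1"
      "row_bounded N c"
    and D: "admissible_perturbation A D"
    and E: "E \<in> L_inf" and GE_min: "minimal_nonneg (solves_G (\<lambda>i. A i + D i)) (G + E)"
  shows "norm_inf E \<le> c / (1 - g) * norm_inf (Delta_A D G)
    + c / (1 - g) * ((1 / (\<theta> * (1 - \<gamma>)))\<^sup>2 + 3 * (1 / (\<theta> * (1 - \<gamma>)))) * (\<Sum>i=-1..1. norm_inf (D i))\<^sup>2"
proof -
  define l where "l = 1 / (\<theta> * (1 - \<gamma>))"
  define \<delta> where "\<delta> = (\<Sum>i=-1..1. norm_inf (D i))"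
  define e where "e = norm_inf E"
  define H where "H = D 1 \<odot> ((G + E) \<odot> (G + E)) + D 0 \<odot> (G + E) + D (-1)"
  define Q where "Q = A 1 \<odot> (E \<odot> E) + D 1 \<odot> (G \<odot> E + E \<odot> (G + E)) + D 0 \<odot> E"
  have G: "0 \<le> G" "solves_G A G" and GE: "0 \<le> G + E" "solves_G (\<lambda>i. A i + D i) (G + E)"
    using G_min GE_min by (auto simp: minimal_nonneg_def)
  have G_bound: "row_bounded G 1"
    by (rule minimal_solution_row_bounded[OF in_L_inf nonneg _ G_min]) (simp add: row_sums)
  have GL: "G \<in> L_inf"
    by (rule row_bounded_imp_L_inf[OF G_bound])
  note DL = admissible_perturbationD(1)[OF D]
  \<comment> \<open>The perturbed coefficients are again nonnegative with total row sums 1, so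
    \<open>G + E\<close> is substochastic however large the perturbation is.\<close>
  have GE_bound: "row_bounded (G + E) 1"
    by (rule minimal_solution_row_bounded[OF _ _ _ _ _ _ _ GE_min])
       (use admissible_perturbationD[OF D] in \<open>simp_all add: in_L_inf\<close>)
  have A1: "row_bounded (A 1) 1"
    unfolding row_bounded_iff_row_sums[OF in_L_inf(1) nonneg(1)]
  proof
    fix i
    have "0 \<le> mat_vec (A k) ones i" if "k \<in> {0, -1}" for k
      unfolding mat_vec_def using that nonneg in_L_inf
      by (intro suminf_nonneg abs_mat_vec_le(1)[OF row_bounded_norm_inf abs_ones_le])
         (auto simp: ones_def imat_nonneg_iff)
    from this[of 0] this[of "-1"] row_sums[of i] show "mat_vec (A 1) ones i \<le> 1"
      by simp
  qed
  have delta: "\<delta> = norm_inf (D (-1)) + norm_inf (D 0) + norm_inf (D 1)"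
    by (simp add: \<delta>_def sum_minus_one_to_one)
  have D_nonneg: "0 \<le> norm_inf (D (-1))" "0 \<le> norm_inf (D 0)" "0 \<le> norm_inf (D 1)"
    using DL by (auto intro: norm_inf_nonneg)
  have d: "0 \<le> \<delta>"
    using D_nonneg by (simp add: delta)
  have e: "0 \<le> e"
    unfolding e_def by (rule norm_inf_nonneg[OF E])
  have l: "0 \<le> l"
    using theta_pos \<open>\<gamma> < 1\<close> by (simp add: l_def)
  note DB = row_bounded_norm_inf[OF DL]
  have "row_bounded H (norm_inf (D 1) * (1 * 1) + norm_inf (D 0) * 1 + norm_inf (D (-1)))"
    unfolding H_def by (intro row_bounded_add row_bounded_mat_mult DB GE_bound) auto
  then have H: "H \<in> L_inf" "norm_inf H \<le> \<delta>"
    by (auto simp: delta algebra_simps intro: row_bounded_imp_L_inf dest: norm_inf_le)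
  have "e \<le> l * norm_inf H"
    unfolding e_def l_def H_def
    by (rule linear_perturbation_bound[OF GE(1) GE_bound G_bound \<open>\<gamma> < 1\<close> E
          H(1)[unfolded H_def] solution_difference_eq(1)[OF GL E DL G(2) GE(2)]])
  then have e_le: "e \<le> l * \<delta>"
    using mult_left_mono[OF H(2) l] by simp
  \<comment> \<open>Keeping \<open>G + E\<close> as one factor with row bound 1 avoids a cubic
    term.\<close>
  have "row_bounded Q (1 * (e * e) + norm_inf (D 1) * (1 * e + e * 1) + norm_inf (D 0) * e)"
    unfolding Q_def e_def
    by (intro row_bounded_add row_bounded_mat_mult DB GE_bound G_bound A1 row_bounded_norm_inf E) auto
  then have Q: "Q \<in> L_inf" "norm_inf Q \<le> e * e + norm_inf (D 1) * (2 * e) + norm_inf (D 0) * e"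
    by (auto intro: row_bounded_imp_L_inf dest: norm_inf_le)
  have "norm_inf Q \<le> e * e + \<delta> * (2 * e) + \<delta> * e"
    using e D_nonneg
    by (intro order_trans[OF Q(2)] add_mono mult_right_mono order_refl) (auto simp: delta)
  also have "\<dots> \<le> (l * \<delta>) * (l * \<delta>) + \<delta> * (2 * (l * \<delta>)) + \<delta> * (l * \<delta>)"
    using e e_le d l by (intro add_mono mult_mono mult_left_mono) auto
  also have "\<dots> = (l\<^sup>2 + 3 * l) * \<delta>\<^sup>2"
    by (simp add: power2_eq_square algebra_simps)
  finally have Q_le: "norm_inf Q \<le> (l\<^sup>2 + 3 * l) * \<delta>\<^sup>2" .
  have "Delta_A D G \<in> L_inf"
    using DL GL by (simp add: Delta_A_def)
  then have "norm_inf E \<le> c / (1 - g) * norm_inf (Delta_A D G + Q)"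
    using norm_bound_of_linear_equation[OF N(1) _ in_L_inf(1) E _ G_bound N(2-4)
        solution_difference_eq(2)[OF GL E DL G(2) GE(2)]] Q(1) GL
    by (simp add: in_L_inf Q_def)
  also have "\<dots> \<le> c / (1 - g) * (norm_inf (Delta_A D G) + (l\<^sup>2 + 3 * l) * \<delta>\<^sup>2)"
    using norm_inf_add[OF \<open>Delta_A D G \<in> L_inf\<close> Q(1)] Q_le row_bounded_nonneg[OF N(4)] N(3)
    by (intro mult_left_mono) auto
  finally show ?thesis
    by (simp add: l_def \<delta>_def algebra_simps)
qed

end

theorem theorem6p1:
  fixes a b :: "int \<Rightarrow> int \<Rightarrow> real"
    and A :: "int \<Rightarrow> imat"
    and G R W :: imat
    and \<theta> \<gamma> :: real
  assumes a_nonneg: "\<And>i j. i \<in> {-1..1} \<Longrightarrow> j \<in> {-1..1} \<Longrightarrow> a i j \<ge> 0"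
    and b_nonneg: "\<And>i j. i \<in> {-1..1} \<Longrightarrow> j \<in> {0..1} \<Longrightarrow> b i j \<ge> 0"
    and a_sum: "(\<Sum>i=-1..1. \<Sum>j=-1..1. a i j) = 1"
    and b_sum: "(\<Sum>i=-1..1. \<Sum>j=0..1. b i j) = 1"
    and nondegenerate: "\<exists>i\<in>{-1..1}. card {j \<in> {-1..1}. a i j \<noteq> 0} \<ge> 2"
    and A_def: "A = qbd_block a b"
    and G_min: "minimal_nonneg (solves_G A) G"
    and R_min: "minimal_nonneg (solves_R A) R"
    and W_def: "W = id_mat - A 0 - A 1 \<odot> G"
    and drift: "\<And>r. mat_vec (A (-1)) ones r > mat_vec (A 1) ones r"
    and theta_def: "\<theta> = min (a_sym a (-1) 1) (b_sym b (-1) 1)"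
    and gamma_def: "\<gamma> = max (a_sym a 1 1 / a_sym a (-1) 1) (b_sym b 1 1 / b_sym b (-1) 1)"
  shows "invertible_L_inf W \<and> norm_inf (inv_mat W \<odot> R \<odot> W) < 1 \<and>
    (\<exists>K. \<forall>D. admissible_perturbation A D \<longrightarrow>
      \<comment> \<open>the relation without the higher order terms\<close>
      (\<forall>D_G \<in> QT. (id_mat - A 1 \<odot> G - A 0) \<odot> D_G - A 1 \<odot> D_G \<odot> G = Delta_A D G \<longrightarrow>
        norm_inf D_G \<le>
          norm_inf (inv_mat W) / (1 - norm_inf (inv_mat W \<odot> R \<odot> W)) * norm_inf (Delta_A D G)) \<and>
      \<comment> \<open>the actual perturbation of \<open>G\<close>, up to second order terms\<close>
      (\<forall>D_G \<in> QT. minimal_nonneg (solves_G (\<lambda>i. A i + D i)) (G + D_G) \<longrightarrow>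
        norm_inf D_G \<le>
          norm_inf (inv_mat W) / (1 - norm_inf (inv_mat W \<odot> R \<odot> W)) * norm_inf (Delta_A D G)
          + K * (\<Sum>i=-1..1. norm_inf (D i))\<^sup>2) \<and>
      norm_inf (inv_mat W) / (1 - norm_inf (inv_mat W \<odot> R \<odot> W)) * norm_inf (Delta_A D G)
        \<le> 1 / (\<theta> * (1 - \<gamma>)) * norm_inf (Delta_A D G) \<and>
      1 / (\<theta> * (1 - \<gamma>)) * norm_inf (Delta_A D G)
        \<le> 1 / (\<theta> * (1 - \<gamma>)) * (norm_inf (D (-1)) + norm_inf (D 0) + norm_inf (D 1)))"
proof -
  have block: "0 \<le> A i" "A i \<in> L_inf"
    "mat_vec (A i) ones r = (if r = 0 then b_sym b i 1 else a_sym a i 1)"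
    if "i \<in> {-1..1}" for i r
    using qbd_block_row[of a i b] a_nonneg b_nonneg that by (auto simp: A_def)
  have sym_nonneg: "0 \<le> a_sym a 1 1" "0 \<le> b_sym b 1 1"
    using a_nonneg b_nonneg by (auto simp: a_sym_def b_sym_def)
  \<comment> \<open>Row 0 carries the boundary coefficients; row 1 represents all interior
    rows.\<close>
  have drift': "b_sym b 1 1 < b_sym b (-1) 1" "a_sym a 1 1 < a_sym a (-1) 1"
    using drift[of 0] drift[of 1] by (simp_all add: block)
  \<comment> \<open>The strict drift makes the denominators in \<open>\<gamma>\<close> positive, and
    with them \<open>\<theta>\<close>.\<close>
  have pos: "0 < a_sym a (-1) 1" "0 < b_sym b (-1) 1"
    using drift' sym_nonneg by linarith+
  have gamma_less: "\<gamma> < 1"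
    using drift' pos by (simp add: gamma_def)
  have "{0..1} = {0, 1 :: int}"
    by auto
  then have sums: "a_sym a 1 1 + a_sym a 0 1 + a_sym a (-1) 1 = 1"
    "b_sym b 1 1 + b_sym b 0 1 + b_sym b (-1) 1 = 1"
    using a_sum b_sum by (simp_all add: sum_minus_one_to_one a_sym_def b_sym_def)
  have gamma_le: "a_sym a 1 1 \<le> \<gamma> * a_sym a (-1) 1" "b_sym b 1 1 \<le> \<gamma> * b_sym b (-1) 1"
    using pos by (simp_all add: gamma_def flip: pos_divide_le_eq)
  interpret drifted_qbd A \<theta> \<gamma>
  proof
    show "0 \<le> \<gamma>"
      using sym_nonneg pos by (simp add: gamma_def le_max_iff_disj)
  qed (use block sums pos gamma_le in \<open>auto simp: theta_def\<close>)
  have G_nonneg: "0 \<le> G"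
    using G_min by (simp add: minimal_nonneg_def)
  have G_bound: "row_bounded G 1"
    by (rule minimal_solution_row_bounded[OF in_L_inf nonneg _ G_min]) (simp add: row_sums)
  have GL: "G \<in> L_inf"
    by (rule row_bounded_imp_L_inf[OF G_bound])
  have WL: "W \<in> L_inf"
    by (simp add: W_def in_L_inf GL)
  obtain N where N: "0 \<le> N" "row_bounded N (1 / \<theta>)" "is_inverse_mat W N" "row_bounded (N \<odot> A 1) \<gamma>"
    using inverse_bounds[OF G_nonneg G_bound] by (auto simp: W_def)
  have NL: "N \<in> L_inf"
    by (rule row_bounded_imp_L_inf[OF N(2)])
  have inv: "inv_mat W = N"
    by (rule inv_mat_eq[OF WL N(3)])
  have R_eq: "R = A 1 \<odot> N"
    using minimal_R_eq[OF G_min R_min G_bound N(1)] N(3) by (simp add: W_def)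
  have NRW: "N \<odot> R \<odot> W = N \<odot> A 1"
    using N(3) by (simp add: R_eq mat_mult_assoc NL WL in_L_inf is_inverse_mat_def)
  \<comment> \<open>The exact norms are kept for the first inequality; \<open>\<gamma>\<close> and
    \<open>1 / \<theta>\<close> enter the chain only through \<open>coeff\<close>.\<close>
  define g where "g = norm_inf (N \<odot> A 1)"
  define c where "c = norm_inf N"
  have g: "row_bounded (N \<odot> A 1) g" "g \<le> \<gamma>" and c: "row_bounded N c" "c \<le> 1 / \<theta>"
    using norm_inf_le[OF N(4)] norm_inf_le[OF N(2)] NL in_L_inf
    by (auto simp: g_def c_def intro: row_bounded_norm_inf)
  have g1: "g < 1"
    using g(2) gamma_less by simp
  have coeff: "c / (1 - g) \<le> 1 / (\<theta> * (1 - \<gamma>))"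
    using frac_le[OF _ c(2), of "1 - \<gamma>" "1 - g"] g(2) gamma_less theta_pos by simp
  \<comment> \<open>The factor of the quadratic term is written out to show that it does not depend
    on \<open>D\<close>; it is the witness for \<open>K\<close>.\<close>
  have main: "(\<forall>E\<in>QT. (id_mat - A 1 \<odot> G - A 0) \<odot> E - A 1 \<odot> E \<odot> G = Delta_A D G \<longrightarrow>
        norm_inf E \<le> c / (1 - g) * norm_inf (Delta_A D G)) \<and>
      (\<forall>E\<in>QT. minimal_nonneg (solves_G (\<lambda>i. A i + D i)) (G + E) \<longrightarrow>
        norm_inf E \<le> c / (1 - g) * norm_inf (Delta_A D G)
          + c / (1 - g) * ((1 / (\<theta> * (1 - \<gamma>)))\<^sup>2 + 3 * (1 / (\<theta> * (1 - \<gamma>)))) * (\<Sum>i=-1..1. norm_inf (D i))\<^sup>2) \<and>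
      c / (1 - g) * norm_inf (Delta_A D G) \<le> 1 / (\<theta> * (1 - \<gamma>)) * norm_inf (Delta_A D G) \<and>
      1 / (\<theta> * (1 - \<gamma>)) * norm_inf (Delta_A D G)
        \<le> 1 / (\<theta> * (1 - \<gamma>)) * (norm_inf (D (-1)) + norm_inf (D 0) + norm_inf (D 1))"
    if D: "admissible_perturbation A D" for D
  proof (intro conjI ballI impI)
    note DL = admissible_perturbationD(1)[OF D]
    have Delta: "Delta_A D G \<in> L_inf"
      using DL GL by (simp add: Delta_A_def)
    show "norm_inf E \<le> c / (1 - g) * norm_inf (Delta_A D G)"
      if "E \<in> QT" "(id_mat - A 1 \<odot> G - A 0) \<odot> E - A 1 \<odot> E \<odot> G = Delta_A D G" for E
    proof (rule norm_bound_of_linear_equation[OF N(3) WL in_L_inf(1) _ Delta G_bound g(1) g1 c(1)])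
      show "E \<in> L_inf"
        using that(1) QT_subset_L_inf by auto
      have "W = id_mat - A 1 \<odot> G - A 0"
        by (simp add: W_def algebra_simps)
      with that(2) show "W \<odot> E - A 1 \<odot> E \<odot> G = Delta_A D G"
        by simp
    qed
    show "norm_inf E \<le> c / (1 - g) * norm_inf (Delta_A D G)
        + c / (1 - g) * ((1 / (\<theta> * (1 - \<gamma>)))\<^sup>2 + 3 * (1 / (\<theta> * (1 - \<gamma>)))) * (\<Sum>i=-1..1. norm_inf (D i))\<^sup>2"
      if "E \<in> QT" "minimal_nonneg (solves_G (\<lambda>i. A i + D i)) (G + E)" for E
      by (rule quadratic_perturbation_bound[OF gamma_less G_min N(3)[unfolded W_def] g(1) g1 c(1) D
            _ that(2)])
         (use that(1) QT_subset_L_inf in auto)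
    show "c / (1 - g) * norm_inf (Delta_A D G) \<le> 1 / (\<theta> * (1 - \<gamma>)) * norm_inf (Delta_A D G)"
      by (intro mult_right_mono coeff norm_inf_nonneg Delta)
    have "row_bounded (Delta_A D G) (norm_inf (D 1) * (1 * 1) + norm_inf (D 0) * 1 + norm_inf (D (-1)))"
      unfolding Delta_A_def
      by (intro row_bounded_add row_bounded_mat_mult row_bounded_norm_inf DL G_bound) auto
    then have "norm_inf (Delta_A D G) \<le> norm_inf (D (-1)) + norm_inf (D 0) + norm_inf (D 1)"
      by (auto dest: norm_inf_le)
    then show "1 / (\<theta> * (1 - \<gamma>)) * norm_inf (Delta_A D G)
        \<le> 1 / (\<theta> * (1 - \<gamma>)) * (norm_inf (D (-1)) + norm_inf (D 0) + norm_inf (D 1))"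
      using theta_pos gamma_less by (intro mult_left_mono) auto
  qed
  have "invertible_L_inf W"
    using WL N(3) by (auto simp: invertible_L_inf_def)
  then show ?thesis
    unfolding inv NRW g_def[symmetric] c_def[symmetric] using g1 main by blast
qed

end
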